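(* Let $r\in\mathbb{N}$, let $K,J\subset\mathbb{R}^{d+1}$ be measurable sets, and let $h\in\mathbb{R}^{d+1}\setminus\{0\}$ be such that $$J\subset\bigcap_{j=1}^r(K+jh)\quad\text{and}\quad[\xi-rh,\xi]\subset K\cup J\ \text{ for all }\xi\in J.$$ Let $0<p\le\infty$, $\theta=\min\{p,1\}$, $e=h/\|h\|$, and let $\mathcal{E}\subset\mathbb{S}^d$ satisfy $\mathrm{span}(\mathcal{E})=\mathbb{R}^{d+1}$ and $e\in\mathcal{E}$. Then for every $f\in L^p(K\cup J)$, $$E_{r-1}(f;\mathcal{E})^\theta_{L^p(K\cup J)}\le\omega^r(f,K\cup J;e)_p^\theta+2^r\,E_{r-1}(f;\mathcal{E})^\theta_{L^p(K)}.$$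
   Context: $\mathbb{S}^d$ is the unit sphere of $\mathbb{R}^{d+1}$, $\|\cdot\|$ the Euclidean norm, $[\xi,\eta]$ the segment joining $\xi$ and $\eta$. For $\mathcal{E}\subset\mathbb{S}^d$ with $\mathrm{span}(\mathcal{E})=\mathbb{R}^{d+1}$, $\Pi^{d+1}_{r-1}(\mathcal{E})$ is the set of all algebraic polynomials $Q$ on $\mathbb{R}^{d+1}$ such that for every $x\in\mathbb{R}^{d+1}$ and $e\in\mathcal{E}$ the function $t\mapsto Q(x+te)$ is a polynomial of degree $<r$ in $t\in\mathbb{R}$; this is a finite-dimensional space. For a set $G$, $E_{r-1}(f;\mathcal{E})_{L^p(G)}=\inf\{\|f-Q\|_{L^p(G)}:Q\in\Pi^{d+1}_{r-1}(\mathcal{E})\}$. $\triangle^r_\xi f(\eta)=\sum_{j=0}^r(-1)^{r+j}\binom rjf(\eta+j\xi)$. For a set $G$ and a direction $e\in\mathbb{S}^d$, $\omega^r(f,G;e)_p=\sup_{0<u\le\mathrm{diam}(G)}\|\triangle^r_{ue}f\|_{L^p(\{\xi\in G:[\xi,\xi+rue]\subset G\})}$. *)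

theory Defs
  imports "HOL-Analysis.Analysis" "HOL-Computational_Algebra.Polynomial"
begin

(* Powers of extended nonnegative numbers; used only with exponents a > 0, so that
   0 is sent to 0 and infinity to infinity. *)
definition epowr :: "ennreal \<Rightarrow> real \<Rightarrow> ennreal" where
  "epowr x a = (if x = \<infinity> then \<infinity> else ennreal (enn2real x powr a))"

(* The L^p(G) (quasi-)norm for 0 < p <= infinity.  G and g need not be measurable: then the
   integral is the library's nn_integral, i.e. a supremum over simple functions below the
   integrand, and the essential supremum ignores subsets of null sets.  This
   matters in directional_modulus, since the set of the \<xi> whose segment stays in G may fail to
   be Lebesgue measurable even when G is measurable. *)
definition Lp_norm :: "ennreal \<Rightarrow> ('a::euclidean_space) set \<Rightarrow> ('a \<Rightarrow> real) \<Rightarrow> ennreal" where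
  "Lp_norm p G g =
    (if p = \<infinity> then Inf {c. AE x in lebesgue. x \<in> G \<longrightarrow> ennreal \<bar>g x\<bar> \<le> c}
     else epowr (\<integral>\<^sup>+x\<in>G. ennreal (\<bar>g x\<bar> powr enn2real p) \<partial>lebesgue) (1 / enn2real p))"

definition Lp_space :: "ennreal \<Rightarrow> ('a::euclidean_space) set \<Rightarrow> ('a \<Rightarrow> real) set" where
  "Lp_space p G = {f. f \<in> borel_measurable (lebesgue_on G) \<and> Lp_norm p G f < \<infinity>}"

(* directional_polys r E is the space written with index r - 1.  The disjunct q = 0 reflects
   that the zero polynomial has degree minus infinity (the library's degree is 0). *)
definition directional_polys ::
  "nat \<Rightarrow> ('a::euclidean_space) set \<Rightarrow> ('a \<Rightarrow> real) set" where
  "directional_polys r E =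
    {Q. real_polynomial_function Q \<and>
        (\<forall>x. \<forall>e\<in>E. \<exists>q :: real poly. (q = 0 \<or> degree q < r) \<and>
           (\<forall>t::real. Q (x + t *\<^sub>R e) = poly q t))}"

definition best_approx ::
  "nat \<Rightarrow> ennreal \<Rightarrow> ('a::euclidean_space) set \<Rightarrow> 'a set \<Rightarrow> ('a \<Rightarrow> real) \<Rightarrow> ennreal" where
  "best_approx r p E G f = (INF Q\<in>directional_polys r E. Lp_norm p G (\<lambda>x. f x - Q x))"

definition fwd_diff :: "nat \<Rightarrow> ('a::euclidean_space) \<Rightarrow> ('a \<Rightarrow> real) \<Rightarrow> 'a \<Rightarrow> real" where
  "fwd_diff r \<xi> f \<eta> = (\<Sum>j=0..r. (-1) ^ (r + j) * real (r choose j) * f (\<eta> + real j *\<^sub>R \<xi>))"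

(* The library's diameter is a real number, unspecified for unbounded sets. *)
definition ediameter :: "('a::metric_space) set \<Rightarrow> ennreal" where
  "ediameter G = (SUP x\<in>G. SUP y\<in>G. ennreal (dist x y))"

definition directional_modulus ::
  "nat \<Rightarrow> ennreal \<Rightarrow> ('a::euclidean_space) set \<Rightarrow> 'a \<Rightarrow> ('a \<Rightarrow> real) \<Rightarrow> ennreal" where
  "directional_modulus r p G e f =
    (SUP u\<in>{u::real. 0 < u \<and> ennreal u \<le> ediameter G}.
       Lp_norm p {\<xi> \<in> G. closed_segment \<xi> (\<xi> + (real r * u) *\<^sub>R e) \<subseteq> G} (fwd_diff r (u *\<^sub>R e) f))"

end

theory Submission
  imports Defs
begin

text \<open>
  Fix \<open>Q\<close> in the polynomial space and put \<open>g = f - Q\<close>.  Along the direction \<open>e\<close> the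
  polynomial \<open>Q\<close> has degree less than \<open>r\<close>, so its \<open>r\<close>-th difference with step \<open>h\<close> vanishes and
  \<open>g\<close> has the same \<open>r\<close>-th difference as \<open>f\<close>.  For \<open>\<xi> \<in> J\<close> the difference based at
  \<open>\<xi> - r h\<close> can be solved for its last term \<open>g \<xi>\<close>: this value is bounded by the difference of
  \<open>f\<close> plus the sum over \<open>j < r\<close> of \<open>r choose j\<close> times \<open>\<bar>g (\<xi> - (r - j) h)\<bar>\<close>, and all these
  points lie in \<open>K\<close> because \<open>J\<close> lies in every \<open>K + i h\<close> with \<open>1 \<le> i \<le> r\<close>.  Together with the
  values of \<open>g\<close> on \<open>K\<close> itself this bounds \<open>g\<close> on \<open>K \<union> J\<close> by one \<open>r\<close>-th difference of \<open>f\<close> and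
  translates of \<open>g\<close> restricted to \<open>K\<close>, of total weight
  \<open>1 + (\<Sum>j<r. r choose j) = 2 ^ r\<close> (lemma \<open>extension_Lp_theta\<close>).

  The power \<open>\<theta> = min p 1\<close> of the quasi-norm is monotone, subadditive and invariant under
  translations.  Subadditivity (lemma \<open>Lp_theta_add\<close>) is Minkowski's inequality for \<open>p \<ge> 1\<close> and
  the scalar inequality \<open>(s + t) powr p \<le> s powr p + t powr p\<close> for \<open>p < 1\<close>.  An integer weight
  only means that a term is repeated, so subadditivity takes care of the binomial coefficients
  as well.

  The difference of \<open>f\<close> is controlled by the modulus at \<open>u = norm h\<close>: moving the base point
  from \<open>\<xi>\<close> to \<open>\<xi> - r h\<close> sends \<open>J\<close> into the set over which the modulus is taken, by the segment
  condition (lemma \<open>Lp_theta_difference_le_modulus\<close>).  Taking the infimum over \<open>Q\<close> finishes the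
  proof, since \<open>\<theta>\<close>-th powers commute with infima (lemma \<open>epowr_INF\<close>).
\<close>

section \<open>Powers of extended nonnegative numbers\<close>

lemma epowr_infinity [simp]: "epowr \<infinity> a = \<infinity>" "epowr top a = top"
  by (simp_all add: epowr_def)

lemma epowr_ennreal: "0 \<le> x \<Longrightarrow> epowr (ennreal x) a = ennreal (x powr a)"
  by (simp add: epowr_def)

lemma epowr_zero [simp]: "epowr 0 a = 0"
  by (simp add: epowr_def)

lemma epowr_one [simp]: "epowr x 1 = x"
  by (cases x) (auto simp: epowr_ennreal)

lemma epowr_epowr: "epowr (epowr x a) b = epowr x (a * b)"
  by (cases x) (auto simp: epowr_ennreal powr_powr)

lemma epowr_mono: "x \<le> y \<Longrightarrow> 0 < a \<Longrightarrow> epowr x a \<le> epowr y a"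
  by (cases x; cases y) (auto simp: epowr_ennreal top_unique intro!: ennreal_leI powr_mono2)

lemma le_epowr_iff:
  assumes "0 < a"
  shows "y \<le> epowr x a \<longleftrightarrow> epowr y (1 / a) \<le> x"
proof
  assume "y \<le> epowr x a"
  from epowr_mono[OF this, of "1 / a"] assms show "epowr y (1 / a) \<le> x"
    by (simp add: epowr_epowr)
next
  assume "epowr y (1 / a) \<le> x"
  from epowr_mono[OF this assms] assms show "y \<le> epowr x a"
    by (simp add: epowr_epowr)
qed

lemma epowr_less_imp:
  assumes "0 < a" "epowr x (1 / a) < ennreal c" "0 \<le> c"
  shows "x \<le> ennreal (c powr a)"
  using epowr_mono[OF less_imp_le[OF assms(2)] assms(1)] assms
  by (simp add: epowr_epowr epowr_ennreal)

text \<open>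
  A power with positive exponent has an inverse power, so it is an order isomorphism
  and preserves infima.  This argument covers infinite values and empty index sets at once.
\<close>

lemma epowr_INF:
  assumes "0 < a"
  shows "epowr (INF i\<in>I. F i) a = (INF i\<in>I. epowr (F i) a)"
proof (rule antisym)
  show "epowr (INF i\<in>I. F i) a \<le> (INF i\<in>I. epowr (F i) a)"
    by (intro INF_greatest epowr_mono INF_lower assms)
  have "epowr (INF i\<in>I. epowr (F i) a) (1 / a) \<le> F i" if "i \<in> I" for i
    using that by (subst le_epowr_iff[OF assms, symmetric]) (rule INF_lower)
  then show "(INF i\<in>I. epowr (F i) a) \<le> epowr (INF i\<in>I. F i) a"
    by (subst le_epowr_iff[OF assms]) (rule INF_greatest)
qed

lemma le_add_mult_INF_ennreal:
  fixes y w c :: ennreal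
  assumes "\<And>i. i \<in> I \<Longrightarrow> y \<le> w + c * z i" "c \<noteq> 0" "c \<noteq> top"
  shows "y \<le> w + c * (INF i\<in>I. z i)"
proof (cases "w = top")
  case False
  have "(y - w) / c \<le> z i" if "i \<in> I" for i
  proof (rule divide_le_posI_ennreal)
    show "0 < c" using assms(2) by (simp add: zero_less_iff_neq_zero)
    show "y - w \<le> c * z i"
      using assms(1)[OF that] False by (simp add: ennreal_minus_le_iff)
  qed
  then have "(y - w) / c \<le> (INF i\<in>I. z i)" by (rule INF_greatest)
  then have "c * ((y - w) / c) \<le> c * (INF i\<in>I. z i)" by (rule mult_left_mono) simp
  moreover have "c * ((y - w) / c) = y - w"
    using assms(2,3) by (metis ennreal_times_divide mult.commute mult_divide_eq_ennreal)
  ultimately have "y - w \<le> c * (INF i\<in>I. z i)" by simp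
  then show ?thesis using False by (simp add: ennreal_minus_le_iff)
qed simp

section \<open>Finite differences of directional polynomials\<close>

lemma fwd_diff_0: "fwd_diff 0 \<xi> f \<eta> = f \<eta>"
  by (simp add: fwd_diff_def)

text \<open>
  Pascal's rule.  Taking the simple difference first is what makes the degree drop by one
  in each step of an induction on the order.
\<close>

lemma fwd_diff_Suc:
  "fwd_diff (Suc r) \<xi> f \<eta> = fwd_diff r \<xi> (\<lambda>x. f (x + \<xi>) - f x) \<eta>"
proof -
  define a where "a j = f (\<eta> + real j *\<^sub>R \<xi>)" for j
  define b where "b j = (-1) ^ (r + j) * real (r choose j) * a (Suc j)" for j
  define c where "c j = (-1) ^ (r + j) * real (r choose j) * a j" for j
  have "fwd_diff (Suc r) \<xi> f \<eta>
      = (-1) ^ Suc r * a 0 + (\<Sum>j\<le>r. (-1) ^ (r + j) * real (Suc r choose Suc j) * a (Suc j))"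
    unfolding fwd_diff_def atLeast0AtMost by (subst sum.atMost_Suc_shift) (simp add: a_def)
  also have "(\<Sum>j\<le>r. (-1) ^ (r + j) * real (Suc r choose Suc j) * a (Suc j))
      = (\<Sum>j\<le>r. b j) - (\<Sum>j\<le>r. c (Suc j))"
    by (simp add: b_def c_def distrib_left distrib_right sum.distrib sum_negf)
  also have "(-1) ^ Suc r * a 0 + ((\<Sum>j\<le>r. b j) - (\<Sum>j\<le>r. c (Suc j)))
      = (\<Sum>j\<le>r. b j) - (\<Sum>j\<le>Suc r. c j)"
    by (subst sum.atMost_Suc_shift) (simp add: c_def)
  also have "\<dots> = (\<Sum>j\<le>r. b j) - (\<Sum>j\<le>r. c j)"
    by (simp add: c_def)
  also have "\<dots> = fwd_diff r \<xi> (\<lambda>x. f (x + \<xi>) - f x) \<eta>"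
    by (simp add: fwd_diff_def atLeast0AtMost b_def c_def a_def algebra_simps sum_subtractf)
  finally show ?thesis .
qed

text \<open>Translation preserves degree and leading coefficient, so the leading terms cancel.\<close>

lemma degree_shift_diff:
  fixes q :: "real poly"
  assumes "degree q < Suc r"
  shows "pcompose q [:u, 1:] - q = 0 \<or> degree (pcompose q [:u, 1:] - q) < r"
proof (cases "degree q = 0 \<or> pcompose q [:u, 1:] = q")
  case True
  moreover have "pcompose q [:u, 1:] = q" if "degree q = 0"
    using that by (auto elim: degree_eq_zeroE)
  ultimately show ?thesis by auto
next
  case False
  have d: "degree (pcompose q [:u, 1:]) = degree q" by (simp add: degree_pcompose)
  have "lead_coeff (pcompose q [:u, 1:]) = lead_coeff q"
    by (subst lead_coeff_comp) auto
  then have "degree (pcompose q [:u, 1:] - q) < degree q"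
    using False d by (intro degree_less_if_less_eqI) (auto simp: degree_diff_le)
  then show ?thesis using assms by simp
qed

lemma fwd_diff_poly:
  fixes F :: "'a::euclidean_space \<Rightarrow> real"
  assumes "\<And>t. F (x + t *\<^sub>R e) = poly q t" "q = 0 \<or> degree q < r"
  shows "fwd_diff r (u *\<^sub>R e) F x = 0"
  using assms
proof (induction r arbitrary: F q)
  case 0
  then show ?case using 0(1)[of 0] by (simp add: fwd_diff_0)
next
  case (Suc r)
  have "F (x + t *\<^sub>R e + u *\<^sub>R e) - F (x + t *\<^sub>R e) = poly (pcompose q [:u, 1:] - q) t" for t
    using Suc.prems(1)[of "t + u"] Suc.prems(1)[of t]
    by (simp add: poly_pcompose algebra_simps)
  then show ?case unfolding fwd_diff_Suc
    using Suc.prems(2) degree_shift_diff[of q r u]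
    by (intro Suc.IH[where q = "pcompose q [:u, 1:] - q"]) auto
qed

lemma fwd_diff_directional_poly:
  assumes "Q \<in> directional_polys r E" "e \<in> E"
  shows "fwd_diff r (u *\<^sub>R e) Q x = 0"
  using assms fwd_diff_poly unfolding directional_polys_def by blast

lemma fwd_diff_diff:
  "fwd_diff r \<xi> (\<lambda>x. f x - g x) \<eta> = fwd_diff r \<xi> f \<eta> - fwd_diff r \<xi> g \<eta>"
  by (simp add: fwd_diff_def right_diff_distrib sum_subtractf)

text \<open>The last term of an \<open>r\<close>-th difference has coefficient 1, so the difference can be solved for it.\<close>

lemma abs_le_fwd_diff:
  "\<bar>g (y + real r *\<^sub>R h)\<bar>
    \<le> \<bar>fwd_diff r h g y\<bar> + (\<Sum>j<r. real (r choose j) * \<bar>g (y + real j *\<^sub>R h)\<bar>)"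
proof -
  define S where "S = (\<Sum>j<r. (-1) ^ (r + j) * real (r choose j) * g (y + real j *\<^sub>R h))"
  have "fwd_diff r h g y = S + g (y + real r *\<^sub>R h)"
    by (simp add: fwd_diff_def atLeast0AtMost S_def flip: lessThan_Suc_atMost)
  then have "\<bar>g (y + real r *\<^sub>R h)\<bar> \<le> \<bar>fwd_diff r h g y\<bar> + \<bar>S\<bar>"
    by linarith
  also have "\<bar>S\<bar> \<le> (\<Sum>j<r. real (r choose j) * \<bar>g (y + real j *\<^sub>R h)\<bar>)"
    unfolding S_def by (rule order_trans[OF sum_abs]) (simp add: abs_mult)
  finally show ?thesis by simp
qed

section \<open>Translation invariance of Lebesgue measure\<close>

lemma measurable_lebesgue_translation [measurable]:
  "(\<lambda>x::'a::euclidean_space. c + x) \<in> lebesgue \<rightarrow>\<^sub>M lebesgue"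
  using lebesgue_affine_measurable[of "\<lambda>_. 1" c] by (simp add: euclidean_representation)

lemma distr_lebesgue_translation:
  "distr lebesgue lebesgue (\<lambda>x::'a::euclidean_space. c + x) = lebesgue"
  using lebesgue_affine_euclidean[of "\<lambda>_. 1" c]
  by (simp add: euclidean_representation density_1)

lemma borel_measurable_lebesgue_translation:
  fixes f :: "'a::euclidean_space \<Rightarrow> 'b::topological_space"
  assumes "f \<in> borel_measurable lebesgue"
  shows "(\<lambda>x. f (x + c)) \<in> borel_measurable lebesgue"
  using measurable_compose[OF measurable_lebesgue_translation assms, of c]
  by (simp add: add.commute)

section \<open>The subadditive power of the quasi-norm\<close>

text \<open>
  The quasi-norm itself fails the triangle inequality for \<open>p < 1\<close>, but its power
  \<open>min p 1\<close> satisfies it for every \<open>p > 0\<close>.  Functions live on the whole space; a restriction to a set is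
  expressed by multiplying with its indicator function.
\<close>

definition Lp_theta :: "ennreal \<Rightarrow> ('a::euclidean_space \<Rightarrow> real) \<Rightarrow> ennreal" where
  "Lp_theta p g = epowr (Lp_norm p UNIV g) (enn2real (min p 1))"

lemma theta_pos: "0 < p \<Longrightarrow> 0 < enn2real (min p 1)"
  by (auto simp: enn2real_positive_iff min_def intro: order_le_less_trans)

lemma Lp_norm_mono:
  assumes "0 < p" "\<And>x. \<bar>f x\<bar> \<le> \<bar>g x\<bar>"
  shows "Lp_norm p UNIV f \<le> Lp_norm p UNIV g"
proof (cases "p = \<infinity>")
  case True
  have "AE x in lebesgue. ennreal \<bar>f x\<bar> \<le> c" if "AE x in lebesgue. ennreal \<bar>g x\<bar> \<le> c" for c
    using that
  proof eventually_elim
    case (elim x)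
    then show ?case using assms(2)[of x] by (meson ennreal_leI order_trans)
  qed
  with True show ?thesis by (simp add: Lp_norm_def Inf_superset_mono Collect_mono)
next
  case False
  then have "0 < enn2real p"
    using assms(1) by (simp add: enn2real_positive_iff top.not_eq_extremum)
  with False show ?thesis
    unfolding Lp_norm_def using assms(2)
    by (auto intro!: epowr_mono nn_integral_mono ennreal_leI powr_mono2 simp: mult_right_mono)
qed

lemma Lp_norm_indicator:
  "Lp_norm p G g = Lp_norm p UNIV (\<lambda>x. indicator G x * g x)"
proof (cases "p = \<infinity>")
  case True
  have "(x \<in> G \<longrightarrow> ennreal \<bar>g x\<bar> \<le> c) \<longleftrightarrow> ennreal \<bar>indicator G x * g x\<bar> \<le> c" for x c
    by (cases "x \<in> G") auto
  with True show ?thesis by (simp add: Lp_norm_def)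
next
  case False
  have "ennreal (\<bar>g x\<bar> powr enn2real p) * indicator G x
      = ennreal (\<bar>indicator G x * g x\<bar> powr enn2real p) * indicator UNIV x" for x
    by (cases "x \<in> G") auto
  with False show ?thesis by (simp add: Lp_norm_def)
qed

lemma Lp_norm_translation:
  fixes g :: "'a::euclidean_space \<Rightarrow> real"
  assumes [measurable]: "g \<in> borel_measurable lebesgue"
  shows "Lp_norm p UNIV (\<lambda>x. g (x + c)) = Lp_norm p UNIV g"
proof (cases "p = \<infinity>")
  case True
  have "(AE x in lebesgue. ennreal \<bar>g (x + c)\<bar> \<le> k) \<longleftrightarrow> (AE x in lebesgue. ennreal \<bar>g x\<bar> \<le> k)" for k
  proof -
    have "(AE x in lebesgue. ennreal \<bar>g x\<bar> \<le> k)
      \<longleftrightarrow> (AE x in distr lebesgue lebesgue (\<lambda>x. c + x). ennreal \<bar>g x\<bar> \<le> k)"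
      by (simp only: distr_lebesgue_translation)
    also have "\<dots> \<longleftrightarrow> (AE x in lebesgue. ennreal \<bar>g (c + x)\<bar> \<le> k)"
      by (rule AE_distr_iff) measurable
    finally show ?thesis by (simp add: add.commute)
  qed
  with True show ?thesis by (simp add: Lp_norm_def)
next
  case False
  have "(\<integral>\<^sup>+x. ennreal (\<bar>g x\<bar> powr enn2real p) \<partial>lebesgue)
    = (\<integral>\<^sup>+x. ennreal (\<bar>g x\<bar> powr enn2real p) \<partial>distr lebesgue lebesgue (\<lambda>x. c + x))"
    by (simp only: distr_lebesgue_translation)
  also have "\<dots> = (\<integral>\<^sup>+x. ennreal (\<bar>g (c + x)\<bar> powr enn2real p) \<partial>lebesgue)"
    by (rule nn_integral_distr) measurable
  finally show ?thesis using False by (simp add: Lp_norm_def add.commute)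
qed

text \<open>
  Convexity of the power on the closed half-line.  If one of the two points is 0, it follows from
  \<open>l powr q \<le> l\<close> for \<open>l\<close> in the unit interval.
\<close>

lemma powr_convex_combination:
  fixes x y c q :: real
  assumes q: "1 \<le> q" and "0 \<le> x" "0 \<le> y" and c: "0 \<le> c" "c \<le> 1"
  shows "((1 - c) * x + c * y) powr q \<le> (1 - c) * x powr q + c * y powr q"
proof -
  have *: "(l * z) powr q \<le> l * z powr q" if "0 \<le> l" "l \<le> 1" "0 \<le> z" for l z :: real
    using powr_mono'[of 1 q l] that q by (simp add: powr_mult mult_right_mono)
  consider "x = 0" | "y = 0" | "0 < x" "0 < y" using assms by linarith
  then show ?thesis
  proof cases
    case 3
    then show ?thesis using convex_onD[OF powr_convex[OF q], of c x y] c by simp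
  qed (use *[of c y] *[of "1 - c" x] assms in auto)
qed

text \<open>
  Convexity applied to \<open>s / a\<close> and \<open>t / b\<close> with weights proportional to \<open>a\<close> and \<open>b\<close>.  If
  \<open>s\<close> and \<open>t\<close> are the values of functions with norms at most \<open>a\<close> and \<open>b\<close>,
  the bracket integrates to at most 1.
\<close>

lemma powr_add_le_weighted:
  fixes s t a b q :: real
  assumes "1 \<le> q" "0 \<le> s" "0 \<le> t" "0 < a" "0 < b"
  shows "(s + t) powr q
    \<le> (a + b) powr q * (a / (a + b) * a powr (- q) * s powr q + b / (a + b) * b powr (- q) * t powr q)"
proof -
  have c: "1 - b / (a + b) = a / (a + b)" using assms by (simp add: field_simps)
  have "(a + b) * (a / (a + b) * (s / a) + b / (a + b) * (t / b)) = s + t"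
    using assms by (simp add: distrib_left)
  then have "(s + t) powr q = (a + b) powr q * (a / (a + b) * (s / a) + b / (a + b) * (t / b)) powr q"
    using assms by (simp flip: powr_mult)
  also have "\<dots> \<le> (a + b) powr q * (a / (a + b) * (s / a) powr q + b / (a + b) * (t / b) powr q)"
    using powr_convex_combination[of q "s / a" "t / b" "b / (a + b)"] assms
    by (intro mult_left_mono) (simp_all add: c)
  also have "(s / a) powr q = a powr (- q) * s powr q"
    using assms by (simp add: powr_divide powr_minus_divide)
  also have "(t / b) powr q = b powr (- q) * t powr q"
    using assms by (simp add: powr_divide powr_minus_divide)
  finally show ?thesis by (simp add: mult.assoc)
qed

text \<open>
  Minkowski's inequality in terms of strict upper bounds for the two norms.  Strictness
  makes the bounds positive, so one can divide by them, and for \<open>p = \<infinity>\<close> it provides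
  almost everywhere bounds without knowing that the essential supremum is attained.
\<close>

lemma Lp_norm_add_less:
  fixes f g :: "'a::euclidean_space \<Rightarrow> real"
  assumes [measurable]: "f \<in> borel_measurable lebesgue" "g \<in> borel_measurable lebesgue"
    and p: "1 \<le> p" and less: "Lp_norm p UNIV f < ennreal a" "Lp_norm p UNIV g < ennreal b"
  shows "Lp_norm p UNIV (\<lambda>x. f x + g x) \<le> ennreal (a + b)"
proof -
  have ab: "0 < a" "0 < b" using less by (auto intro: ccontr simp: ennreal_neg not_less)
  show ?thesis
  proof (cases "p = \<infinity>")
    case True
    from less True obtain c d where
      c: "AE x in lebesgue. ennreal \<bar>f x\<bar> \<le> c" "c < ennreal a" and
      d: "AE x in lebesgue. ennreal \<bar>g x\<bar> \<le> d" "d < ennreal b"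
      by (auto simp: Lp_norm_def Inf_less_iff)
    from c(1) d(1) have "AE x in lebesgue. ennreal \<bar>f x + g x\<bar> \<le> ennreal (a + b)"
    proof eventually_elim
      case (elim x)
      have "ennreal \<bar>f x + g x\<bar> \<le> ennreal \<bar>f x\<bar> + ennreal \<bar>g x\<bar>"
        by (subst ennreal_plus[symmetric]) (auto intro!: ennreal_leI simp del: ennreal_plus)
      also have "\<dots> \<le> c + d" by (intro add_mono elim)
      also have "\<dots> \<le> ennreal a + ennreal b" using c d by (intro add_mono less_imp_le)
      finally show ?case using ab by simp
    qed
    with True show ?thesis by (auto simp: Lp_norm_def intro!: Inf_lower)
  next
    case False
    define q where "q = enn2real p"
    have q: "1 \<le> q" using p False unfolding q_def
      by (metis enn2real_1 enn2real_mono infinity_ennreal_def top.not_eq_extremum)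
    define I where "I u = (\<integral>\<^sup>+x. ennreal (\<bar>u x\<bar> powr q) \<partial>lebesgue)" for u :: "'a \<Rightarrow> real"
    have norm_eq: "Lp_norm p UNIV u = epowr (I u) (1 / q)" for u :: "'a \<Rightarrow> real"
      using False by (simp add: Lp_norm_def I_def q_def)
    have If: "I f \<le> ennreal (a powr q)" and Ig: "I g \<le> ennreal (b powr q)"
      using less ab q by (auto simp: norm_eq intro!: epowr_less_imp)
    define \<alpha> where "\<alpha> = (a + b) powr q * (a / (a + b) * a powr (- q))"
    define \<beta> where "\<beta> = (a + b) powr q * (b / (a + b) * b powr (- q))"
    have nn: "0 \<le> \<alpha>" "0 \<le> \<beta>" using ab by (auto simp: \<alpha>_def \<beta>_def)
    have "I (\<lambda>x. f x + g x)
      \<le> (\<integral>\<^sup>+x. ennreal \<alpha> * ennreal (\<bar>f x\<bar> powr q) + ennreal \<beta> * ennreal (\<bar>g x\<bar> powr q) \<partial>lebesgue)"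
      unfolding I_def
    proof (rule nn_integral_mono)
      fix x
      have "\<bar>f x + g x\<bar> powr q \<le> (\<bar>f x\<bar> + \<bar>g x\<bar>) powr q"
        using q by (intro powr_mono2) auto
      also have "\<dots> \<le> \<alpha> * \<bar>f x\<bar> powr q + \<beta> * \<bar>g x\<bar> powr q"
        using powr_add_le_weighted[of q "\<bar>f x\<bar>" "\<bar>g x\<bar>" a b] ab q
        by (simp add: \<alpha>_def \<beta>_def distrib_left mult.assoc)
      finally have "ennreal (\<bar>f x + g x\<bar> powr q)
          \<le> ennreal (\<alpha> * \<bar>f x\<bar> powr q + \<beta> * \<bar>g x\<bar> powr q)" by (rule ennreal_leI)
      then show "ennreal (\<bar>f x + g x\<bar> powr q)
          \<le> ennreal \<alpha> * ennreal (\<bar>f x\<bar> powr q) + ennreal \<beta> * ennreal (\<bar>g x\<bar> powr q)"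
        using nn by (simp add: ennreal_mult)
    qed
    also have "\<dots> = ennreal \<alpha> * I f + ennreal \<beta> * I g"
      unfolding I_def by (simp add: nn_integral_add nn_integral_cmult)
    also have "\<dots> \<le> ennreal \<alpha> * ennreal (a powr q) + ennreal \<beta> * ennreal (b powr q)"
      by (intro add_mono mult_left_mono If Ig) auto
    also have "\<dots> = ennreal (\<alpha> * a powr q + \<beta> * b powr q)"
      using nn by (simp add: ennreal_mult)
    also have "\<alpha> * a powr q + \<beta> * b powr q
        = (a + b) powr q * (a / (a + b) * (a powr (- q) * a powr q) + b / (a + b) * (b powr (- q) * b powr q))"
      by (simp add: \<alpha>_def \<beta>_def algebra_simps)
    also have "\<dots> = (a + b) powr q"
      using ab by (simp add: powr_minus add_divide_distrib[symmetric])
    finally have "I (\<lambda>x. f x + g x) \<le> ennreal ((a + b) powr q)" .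
    from epowr_mono[OF this, of "1 / q"] q ab show ?thesis
      by (simp add: norm_eq epowr_ennreal powr_powr)
  qed
qed

lemma Lp_norm_add:
  fixes f g :: "'a::euclidean_space \<Rightarrow> real"
  assumes meas: "f \<in> borel_measurable lebesgue" "g \<in> borel_measurable lebesgue"
    and p: "1 \<le> p"
  shows "Lp_norm p UNIV (\<lambda>x. f x + g x) \<le> Lp_norm p UNIV f + Lp_norm p UNIV g"
proof (rule ennreal_le_epsilon)
  fix \<epsilon> :: real
  assume fin: "Lp_norm p UNIV f + Lp_norm p UNIV g < top" and \<epsilon>: "0 < \<epsilon>"
  then obtain A B where A: "Lp_norm p UNIV f = ennreal A" "0 \<le> A"
    and B: "Lp_norm p UNIV g = ennreal B" "0 \<le> B"
    by (cases "Lp_norm p UNIV f"; cases "Lp_norm p UNIV g") auto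
  have "Lp_norm p UNIV (\<lambda>x. f x + g x) \<le> ennreal ((A + \<epsilon> / 2) + (B + \<epsilon> / 2))"
    using A B \<epsilon> by (intro Lp_norm_add_less meas p) (auto simp: ennreal_less_iff)
  also have "\<dots> = Lp_norm p UNIV f + Lp_norm p UNIV g + ennreal \<epsilon>"
    using A B \<epsilon> by (simp flip: ennreal_plus)
  finally show "Lp_norm p UNIV (\<lambda>x. f x + g x) \<le> Lp_norm p UNIV f + Lp_norm p UNIV g + ennreal \<epsilon>" .
qed

text \<open>
  The fractions \<open>s / (s + t)\<close> and \<open>t / (s + t)\<close> add up to 1, and raising a number
  of the unit interval to a power \<open>q \<le> 1\<close> does not decrease it.
\<close>

lemma powr_add_le_subadditive:
  fixes s t q :: real
  assumes "0 < q" "q \<le> 1" "0 \<le> s" "0 \<le> t"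
  shows "(s + t) powr q \<le> s powr q + t powr q"
proof (cases "s + t = 0")
  case False
  then have pos: "0 < s + t" using assms by linarith
  have *: "x \<le> x powr q" if "0 \<le> x" "x \<le> 1" for x :: real
    using powr_mono'[of q 1 x] that assms by simp
  have "1 = s / (s + t) + t / (s + t)" using pos by (simp add: add_divide_distrib[symmetric])
  also have "\<dots> \<le> (s / (s + t)) powr q + (t / (s + t)) powr q"
    using pos assms by (intro add_mono *) auto
  also have "\<dots> = (s powr q + t powr q) / (s + t) powr q"
    using assms pos by (simp add: powr_divide add_divide_distrib)
  finally show ?thesis using pos by (simp add: field_simps)
qed (use assms in auto)

text \<open>For \<open>p < 1\<close> the exponents \<open>1 / p\<close> and \<open>\<theta> = p\<close> cancel.\<close>

lemma Lp_theta_lt_1: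
  assumes "0 < p" "p < 1"
  shows "Lp_theta p g = (\<integral>\<^sup>+x. ennreal (\<bar>g x\<bar> powr enn2real p) \<partial>lebesgue)"
proof -
  have "p \<noteq> \<infinity>" "min p 1 = p" using assms by (auto simp: min_def)
  moreover have "0 < enn2real p" using theta_pos[OF assms(1)] \<open>min p 1 = p\<close> by simp
  ultimately show ?thesis by (simp add: Lp_theta_def Lp_norm_def epowr_epowr)
qed

lemma Lp_theta_add:
  fixes f g :: "'a::euclidean_space \<Rightarrow> real"
  assumes [measurable]: "f \<in> borel_measurable lebesgue" "g \<in> borel_measurable lebesgue"
    and p: "0 < p"
  shows "Lp_theta p (\<lambda>x. f x + g x) \<le> Lp_theta p f + Lp_theta p g"
proof (cases "p < 1")
  case False
  then have "1 \<le> p" "min p 1 = 1" by (auto simp: min_def)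
  then show ?thesis using Lp_norm_add[OF assms(1,2), of p] by (simp add: Lp_theta_def)
next
  case True
  define q where "q = enn2real p"
  have "min p 1 = p" using True by (auto simp: min_def)
  then have q: "0 < q" "q \<le> 1"
    using theta_pos[OF p] True enn2real_mono[of p 1] by (auto simp: q_def)
  have "(\<integral>\<^sup>+x. ennreal (\<bar>f x + g x\<bar> powr q) \<partial>lebesgue)
    \<le> (\<integral>\<^sup>+x. ennreal (\<bar>f x\<bar> powr q) + ennreal (\<bar>g x\<bar> powr q) \<partial>lebesgue)"
  proof (rule nn_integral_mono)
    fix x
    have "\<bar>f x + g x\<bar> powr q \<le> (\<bar>f x\<bar> + \<bar>g x\<bar>) powr q"
      using q by (intro powr_mono2) auto
    also have "\<dots> \<le> \<bar>f x\<bar> powr q + \<bar>g x\<bar> powr q"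
      using q by (intro powr_add_le_subadditive) auto
    finally show "ennreal (\<bar>f x + g x\<bar> powr q) \<le> ennreal (\<bar>f x\<bar> powr q) + ennreal (\<bar>g x\<bar> powr q)"
      by (subst ennreal_plus[symmetric]) (auto intro!: ennreal_leI simp del: ennreal_plus)
  qed
  also have "\<dots> = (\<integral>\<^sup>+x. ennreal (\<bar>f x\<bar> powr q) \<partial>lebesgue) + (\<integral>\<^sup>+x. ennreal (\<bar>g x\<bar> powr q) \<partial>lebesgue)"
    by (rule nn_integral_add) measurable
  finally show ?thesis using True p by (simp add: Lp_theta_lt_1 q_def)
qed

lemma Lp_theta_mono:
  "0 < p \<Longrightarrow> (\<And>x. \<bar>f x\<bar> \<le> \<bar>g x\<bar>) \<Longrightarrow> Lp_theta p f \<le> Lp_theta p g"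
  unfolding Lp_theta_def by (intro epowr_mono Lp_norm_mono theta_pos)

lemma Lp_theta_zero: "Lp_theta p (\<lambda>x. 0) = 0"
proof -
  have "Inf {c::ennreal. True} = 0" by (simp add: bot_ennreal)
  then show ?thesis by (simp add: Lp_theta_def Lp_norm_def)
qed

lemma Lp_theta_sum:
  fixes F :: "'i \<Rightarrow> 'a::euclidean_space \<Rightarrow> real"
  assumes "0 < p" "finite I" "\<And>i. i \<in> I \<Longrightarrow> F i \<in> borel_measurable lebesgue"
  shows "Lp_theta p (\<lambda>x. \<Sum>i\<in>I. F i x) \<le> (\<Sum>i\<in>I. Lp_theta p (F i))"
  using assms(2,3)
proof (induction I rule: finite_induct)
  case (insert i I)
  have "Lp_theta p (\<lambda>x. F i x + (\<Sum>j\<in>I. F j x)) \<le> Lp_theta p (F i) + Lp_theta p (\<lambda>x. \<Sum>j\<in>I. F j x)"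
    using insert.prems by (intro Lp_theta_add assms(1) borel_measurable_sum) auto
  also have "\<dots> \<le> Lp_theta p (F i) + (\<Sum>j\<in>I. Lp_theta p (F j))"
    using insert.prems by (intro add_left_mono insert.IH) auto
  finally show ?case using insert by simp
qed (simp add: Lp_theta_zero)

text \<open>
  Subadditivity for \<open>n\<close> equal terms; this is how the binomial weights of a difference are handled.
\<close>

lemma Lp_theta_of_nat_mult:
  fixes g :: "'a::euclidean_space \<Rightarrow> real"
  assumes "0 < p" "g \<in> borel_measurable lebesgue"
  shows "Lp_theta p (\<lambda>x. real n * g x) \<le> of_nat n * Lp_theta p g"
  using Lp_theta_sum[of p "{..<n}" "\<lambda>_. g"] assms by simp

lemma Lp_theta_translation:
  "g \<in> borel_measurable lebesgue \<Longrightarrow> Lp_theta p (\<lambda>x. g (x + c)) = Lp_theta p g"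
  by (simp add: Lp_theta_def Lp_norm_translation)

section \<open>Extension from a set to an adjacent layer\<close>

lemma sum_binomial_lessThan: "1 + (\<Sum>j<r. of_nat (r choose j)) = (2 ^ r :: ennreal)"
proof -
  have "(\<Sum>j\<le>r. r choose j) = 1 + (\<Sum>j<r. r choose j)"
    by (simp flip: lessThan_Suc_atMost)
  then have "of_nat (2 ^ r) = (of_nat (1 + (\<Sum>j<r. r choose j)) :: ennreal)"
    by (simp only: choose_row_sum)
  then show ?thesis by simp
qed

lemma borel_measurable_indicator_mult_lebesgue_on:
  fixes f :: "'a::euclidean_space \<Rightarrow> real"
  assumes "S \<in> sets lebesgue" "f \<in> borel_measurable (lebesgue_on S)"
  shows "(\<lambda>x. indicator S x * f x) \<in> borel_measurable lebesgue"
  using assms borel_measurable_restrict_space_iff[of S lebesgue f] by simp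

text \<open>
  On \<open>J\<close> the value of \<open>g\<close> is recovered from one \<open>r\<close>-th difference and from values on \<open>K\<close>,
  which are translates of the restriction of \<open>g\<close> to \<open>K\<close>; each of them has the same norm.
  The difference enters through a measurable function \<open>D\<close> because \<open>g\<close> is only known to be
  measurable on \<open>K \<union> J\<close>, so its difference need not be measurable on the whole space.
\<close>

lemma extension_Lp_theta:
  fixes g :: "'a::euclidean_space \<Rightarrow> real"
  assumes p: "0 < p"
    and [measurable]: "K \<in> sets lebesgue" "D \<in> borel_measurable lebesgue"
    and g: "(\<lambda>x. indicator (K \<union> J) x * g x) \<in> borel_measurable lebesgue"
    and JK: "\<And>\<xi> j. \<xi> \<in> J \<Longrightarrow> j \<in> {1..r} \<Longrightarrow> \<xi> - real j *\<^sub>R h \<in> K"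
    and D: "\<And>\<xi>. \<xi> \<in> J \<Longrightarrow> D (\<xi> - real r *\<^sub>R h) = fwd_diff r h g (\<xi> - real r *\<^sub>R h)"
  shows "Lp_theta p (\<lambda>x. indicator (K \<union> J) x * g x)
    \<le> Lp_theta p D + 2 ^ r * Lp_theta p (\<lambda>x. indicator K x * g x)"
proof -
  define k where "k = (\<lambda>x. \<bar>indicator K x * g x\<bar>)"
  have "k = (\<lambda>x. \<bar>indicator K x * (indicator (K \<union> J) x * g x)\<bar>)"
    by (auto simp: k_def indicator_def)
  with g have k [measurable]: "k \<in> borel_measurable lebesgue" by simp
  have k_shift [measurable]: "(\<lambda>x. k (x + c)) \<in> borel_measurable lebesgue" for c
    by (rule borel_measurable_lebesgue_translation[OF k])
  have D_shift [measurable]: "(\<lambda>x. \<bar>D (x + c)\<bar>) \<in> borel_measurable lebesgue" for c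
    using borel_measurable_lebesgue_translation[of D c] by simp
  define R where "R x = (\<Sum>j<r. real (r choose j) * k (x + (real j - real r) *\<^sub>R h))" for x
  have [measurable]: "R \<in> borel_measurable lebesgue" unfolding R_def by measurable
  have bound: "\<bar>indicator (K \<union> J) x * g x\<bar> \<le> \<bar>\<bar>D (x + - (real r *\<^sub>R h))\<bar> + (k x + R x)\<bar>" for x
  proof -
    have nn: "0 \<le> k y" "0 \<le> R y" for y by (auto simp: k_def R_def intro!: sum_nonneg)
    consider "x \<in> K" | "x \<in> J" "x \<notin> K" | "x \<notin> K \<union> J" by blast
    then show ?thesis
    proof cases
      case 1
      then show ?thesis using nn[of x] by (simp add: k_def)
    next
      case 2
      let ?y = "x - real r *\<^sub>R h"
      have "\<bar>g (?y + real r *\<^sub>R h)\<bar>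
        \<le> \<bar>fwd_diff r h g ?y\<bar> + (\<Sum>j<r. real (r choose j) * \<bar>g (?y + real j *\<^sub>R h)\<bar>)"
        by (rule abs_le_fwd_diff)
      also have "(\<Sum>j<r. real (r choose j) * \<bar>g (?y + real j *\<^sub>R h)\<bar>) = R x"
        unfolding R_def
      proof (rule sum.cong[OF refl])
        fix j assume "j \<in> {..<r}"
        then have "x - real (r - j) *\<^sub>R h \<in> K" by (intro JK 2) auto
        moreover have "x - real (r - j) *\<^sub>R h = x + (real j - real r) *\<^sub>R h"
          "?y + real j *\<^sub>R h = x + (real j - real r) *\<^sub>R h"
          using \<open>j \<in> {..<r}\<close> by (auto simp: of_nat_diff algebra_simps)
        ultimately have "g (?y + real j *\<^sub>R h) = g (x + (real j - real r) *\<^sub>R h)"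
          "x + (real j - real r) *\<^sub>R h \<in> K" by (simp_all only:)
        then show "real (r choose j) * \<bar>g (?y + real j *\<^sub>R h)\<bar>
          = real (r choose j) * k (x + (real j - real r) *\<^sub>R h)" by (simp add: k_def)
      qed
      finally show ?thesis using 2 D nn[of x] by simp
    next
      case 3
      then show ?thesis by simp
    qed
  qed
  have "Lp_theta p (\<lambda>x. indicator (K \<union> J) x * g x)
    \<le> Lp_theta p (\<lambda>x. \<bar>D (x + - (real r *\<^sub>R h))\<bar> + (k x + R x))"
    by (rule Lp_theta_mono[OF p bound])
  also have "\<dots> \<le> Lp_theta p (\<lambda>x. \<bar>D (x + - (real r *\<^sub>R h))\<bar>) + Lp_theta p (\<lambda>x. k x + R x)"
    by (intro Lp_theta_add p D_shift) measurable
  also have "\<dots> \<le> Lp_theta p (\<lambda>x. \<bar>D (x + - (real r *\<^sub>R h))\<bar>) + (Lp_theta p k + Lp_theta p R)"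
    by (intro add_left_mono Lp_theta_add p) measurable
  also have "Lp_theta p (\<lambda>x. \<bar>D (x + - (real r *\<^sub>R h))\<bar>) = Lp_theta p (\<lambda>x. \<bar>D x\<bar>)"
    by (rule Lp_theta_translation) measurable
  also have "Lp_theta p (\<lambda>x. \<bar>D x\<bar>) = Lp_theta p D"
    by (intro antisym Lp_theta_mono p) auto
  also have "Lp_theta p R \<le> (\<Sum>j<r. Lp_theta p (\<lambda>x. real (r choose j) * k (x + (real j - real r) *\<^sub>R h)))"
    unfolding R_def by (intro Lp_theta_sum p) auto
  also have "\<dots> \<le> (\<Sum>j<r. of_nat (r choose j) * Lp_theta p k)"
  proof (rule sum_mono)
    fix j
    show "Lp_theta p (\<lambda>x. real (r choose j) * k (x + (real j - real r) *\<^sub>R h))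
      \<le> of_nat (r choose j) * Lp_theta p k"
      using Lp_theta_of_nat_mult[OF p k_shift] by (simp add: Lp_theta_translation)
  qed
  also have "Lp_theta p k + (\<Sum>j<r. of_nat (r choose j) * Lp_theta p k)
      = (1 + (\<Sum>j<r. of_nat (r choose j))) * Lp_theta p k"
    by (simp add: distrib_right sum_distrib_right)
  also have "\<dots> = 2 ^ r * Lp_theta p k" by (simp only: sum_binomial_lessThan)
  also have "Lp_theta p k = Lp_theta p (\<lambda>x. indicator K x * g x)"
    unfolding k_def by (intro antisym Lp_theta_mono p) auto
  finally show ?thesis by (simp add: add_left_mono)
qed

text \<open>
  A nonempty \<open>J\<close> forces \<open>G\<close> to contain two points at distance \<open>r * norm h\<close>, hence \<open>u = norm h\<close>
  is an admissible step in the modulus.  For empty \<open>J\<close> it need not be, but then \<open>D\<close> is zero.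
\<close>

lemma Lp_theta_difference_le_modulus:
  fixes f :: "'a::euclidean_space \<Rightarrow> real"
  assumes p: "0 < p" and r: "1 \<le> r" and h: "h \<noteq> 0"
    and seg: "\<And>\<xi>. \<xi> \<in> J \<Longrightarrow> closed_segment (\<xi> - real r *\<^sub>R h) \<xi> \<subseteq> G"
    and D: "\<And>\<xi>. \<xi> \<in> J \<Longrightarrow> D (\<xi> - real r *\<^sub>R h) = fwd_diff r h f (\<xi> - real r *\<^sub>R h)"
      "\<And>y. y + real r *\<^sub>R h \<notin> J \<Longrightarrow> D y = 0"
  shows "Lp_theta p D
    \<le> epowr (directional_modulus r p G (h /\<^sub>R norm h) f) (enn2real (min p 1))"
proof (cases "J = {}")
  case True
  then have "D = (\<lambda>x. 0)" using D(2) by auto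
  then show ?thesis by (simp add: Lp_theta_zero)
next
  case False
  then obtain \<xi> where \<xi>: "\<xi> \<in> J" by blast
  define e where "e = h /\<^sub>R norm h"
  have he: "norm h *\<^sub>R e = h" using h by (simp add: e_def)
  define A where "A = {\<xi> \<in> G. closed_segment \<xi> (\<xi> + (real r * norm h) *\<^sub>R e) \<subseteq> G}"
  have "\<xi> - real r *\<^sub>R h \<in> G" "\<xi> \<in> G" using seg[OF \<xi>] by auto
  then have "ennreal (dist (\<xi> - real r *\<^sub>R h) \<xi>) \<le> ediameter G"
    unfolding ediameter_def by (meson SUP_upper2 order_refl)
  moreover have "norm h \<le> dist (\<xi> - real r *\<^sub>R h) \<xi>"
    using r by (simp add: dist_norm mult_left_le_one_le mult_le_cancel_right1)
  ultimately have u: "ennreal (norm h) \<le> ediameter G"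
    by (meson ennreal_leI order_trans)
  have "\<bar>D y\<bar> \<le> \<bar>indicator A y * fwd_diff r h f y\<bar>" for y
  proof (cases "y + real r *\<^sub>R h \<in> J")
    case True
    have "(real r * norm h) *\<^sub>R e = real r *\<^sub>R h"
      by (simp only: he scaleR_scaleR[symmetric])
    then have "y \<in> A" using seg[OF True] by (auto simp: A_def)
    then show ?thesis using D(1)[OF True] by simp
  qed (simp add: D(2))
  then have "Lp_norm p UNIV D \<le> Lp_norm p A (fwd_diff r h f)"
    by (subst Lp_norm_indicator) (rule Lp_norm_mono[OF p])
  also have "\<dots> = Lp_norm p A (fwd_diff r (norm h *\<^sub>R e) f)" by (simp only: he)
  also have "\<dots> \<le> directional_modulus r p G e f"
    unfolding directional_modulus_def A_def using u h by (intro SUP_upper) auto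
  finally show ?thesis
    unfolding Lp_theta_def e_def by (intro epowr_mono theta_pos p)
qed

theorem theorem5p1:
  fixes r :: nat
    and K J :: "(real ^ 'n) set"
    and h e :: "real ^ 'n"
    and p :: ennreal
    and \<theta> :: real
    and \<E> :: "(real ^ 'n) set"
    and f :: "real ^ 'n \<Rightarrow> real"
  assumes "1 \<le> r"
    and "K \<in> sets lebesgue" and "J \<in> sets lebesgue"
    and "h \<noteq> 0"
    and "J \<subseteq> (\<Inter>j\<in>{1..r}. (\<lambda>x. x + real j *\<^sub>R h) ` K)"
    and "\<And>\<xi>. \<xi> \<in> J \<Longrightarrow> closed_segment (\<xi> - real r *\<^sub>R h) \<xi> \<subseteq> K \<union> J"
    and "0 < p"
    and "\<theta> = enn2real (min p 1)"
    and "e = h /\<^sub>R norm h"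
    and "\<E> \<subseteq> sphere 0 1" and "span \<E> = UNIV" and "e \<in> \<E>"
    and "f \<in> Lp_space p (K \<union> J)"
  shows "epowr (best_approx r p \<E> (K \<union> J) f) \<theta>
    \<le> epowr (directional_modulus r p (K \<union> J) e f) \<theta> + 2 ^ r * epowr (best_approx r p \<E> K f) \<theta>"
proof -
  note r = assms(1) and K = assms(2) and J = assms(3) and h = assms(4) and seg = assms(6)
    and p = assms(7) and \<theta> = assms(8) and e = assms(9) and f = assms(13)
  define G where "G = K \<union> J"
  have [measurable]: "G \<in> sets lebesgue" "K \<in> sets lebesgue" "J \<in> sets lebesgue"
    using K J by (auto simp: G_def)
  have he: "norm h *\<^sub>R e = h" using h by (simp add: e)
  have JK: "\<xi> - real j *\<^sub>R h \<in> K" if "\<xi> \<in> J" "j \<in> {1..r}" for \<xi> j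
    using assms(5) that by force
  \<comment> \<open>Cutting \<open>f\<close> off outside \<open>K \<union> J\<close> makes its differences measurable on the whole space without
    changing those whose base point is \<open>\<xi> - r h\<close> for some \<open>\<xi> \<in> J\<close>.\<close>
  define f0 where "f0 = (\<lambda>x. indicator G x * f x)"
  have f0 [measurable]: "f0 \<in> borel_measurable lebesgue"
    using f unfolding f0_def G_def[symmetric] Lp_space_def
    by (intro borel_measurable_indicator_mult_lebesgue_on) auto
  define D where "D y = indicator J (y + real r *\<^sub>R h) * fwd_diff r h f0 y" for y
  have [measurable]: "(\<lambda>y. indicator J (y + real r *\<^sub>R h) :: real) \<in> borel_measurable lebesgue"
    by (rule borel_measurable_lebesgue_translation) measurable
  have [measurable]: "(\<lambda>y. f0 (y + c)) \<in> borel_measurable lebesgue" for c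
    by (rule borel_measurable_lebesgue_translation[OF f0])
  have D_meas: "D \<in> borel_measurable lebesgue"
    unfolding D_def fwd_diff_def by measurable
  have D_J: "D (\<xi> - real r *\<^sub>R h) = fwd_diff r h f (\<xi> - real r *\<^sub>R h)" if "\<xi> \<in> J" for \<xi>
  proof -
    have "\<xi> - real r *\<^sub>R h + real j *\<^sub>R h \<in> G" if "j \<le> r" for j
    proof (cases "j = r")
      case False
      then have "\<xi> - real (r - j) *\<^sub>R h \<in> K" using that \<open>\<xi> \<in> J\<close> by (intro JK) auto
      then show ?thesis using that by (simp add: G_def of_nat_diff algebra_simps)
    qed (use \<open>\<xi> \<in> J\<close> in \<open>simp add: G_def\<close>)
    then show ?thesis using that by (simp add: D_def fwd_diff_def f0_def)
  qed
  have D_le: "Lp_theta p D \<le> epowr (directional_modulus r p G e f) \<theta>"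
    unfolding \<theta> e
  proof (rule Lp_theta_difference_le_modulus[OF p r h])
    show "closed_segment (\<xi> - real r *\<^sub>R h) \<xi> \<subseteq> G" if "\<xi> \<in> J" for \<xi>
      using seg[OF that] by (simp add: G_def)
  qed (auto simp: D_J, simp add: D_def)
  have main: "epowr (best_approx r p \<E> G f) \<theta>
      \<le> epowr (directional_modulus r p G e f) \<theta> + 2 ^ r * epowr (Lp_norm p K (\<lambda>x. f x - Q x)) \<theta>"
    if Q: "Q \<in> directional_polys r \<E>" for Q
  proof -
    have "continuous_on UNIV Q"
      using Q by (auto simp: directional_polys_def intro!: continuous_at_imp_continuous_on
          continuous_real_polymonial_function)
    then have [measurable]: "Q \<in> borel_measurable lebesgue"
      by (intro measurable_completion) (simp add: borel_measurable_continuous_onI)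
    have "(\<lambda>x. indicator G x * (f x - Q x)) = (\<lambda>x. f0 x - indicator G x * Q x)"
      by (simp add: f0_def right_diff_distrib)
    then have meas: "(\<lambda>x. indicator G x * (f x - Q x)) \<in> borel_measurable lebesgue"
      by simp
    have Q0: "fwd_diff r h Q y = 0" for y
      using fwd_diff_directional_poly[OF Q assms(12), of "norm h" y] by (simp only: he)
    have "epowr (best_approx r p \<E> G f) \<theta> \<le> epowr (Lp_norm p G (\<lambda>x. f x - Q x)) \<theta>"
      unfolding \<theta> best_approx_def by (intro epowr_mono INF_lower Q theta_pos p)
    also have "\<dots> = Lp_theta p (\<lambda>x. indicator G x * (f x - Q x))"
      by (simp add: Lp_theta_def Lp_norm_indicator[of p G] \<theta>)
    also have "\<dots> \<le> Lp_theta p D + 2 ^ r * Lp_theta p (\<lambda>x. indicator K x * (f x - Q x))"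
      unfolding G_def
      by (rule extension_Lp_theta[where h = h])
        (use p JK D_meas meas in \<open>auto simp: G_def D_J fwd_diff_diff Q0\<close>)
    also have "Lp_theta p (\<lambda>x. indicator K x * (f x - Q x)) = epowr (Lp_norm p K (\<lambda>x. f x - Q x)) \<theta>"
      by (simp add: Lp_theta_def Lp_norm_indicator[of p K] \<theta>)
    finally show ?thesis using D_le by (meson add_right_mono order_trans)
  qed
  have "0 < \<theta>" using theta_pos[OF p] by (simp add: \<theta>)
  then have "epowr (best_approx r p \<E> K f) \<theta>
      = (INF Q\<in>directional_polys r \<E>. epowr (Lp_norm p K (\<lambda>x. f x - Q x)) \<theta>)"
    unfolding best_approx_def by (rule epowr_INF)
  with le_add_mult_INF_ennreal[OF main, of "directional_polys r \<E>"] show ?thesis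
    by (simp add: G_def power_eq_top_ennreal)
qed

end
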